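(* Let $d \geq 2$ and let $p_1, p_2 \in (0,1]$. There exists $M \in \mathbb{N}$, depending only on $p_1 \wedge p_2 = \min\{p_1,p_2\}$ and $d$, such that the following holds. Let $\mathbf{y} \in \mathbb{Z}^d \setminus \{\mathbf{0}\}$, let $\eta$ be any deterministic initial configuration with $\eta(\mathbf{x}) \in \mathbb{N}$ and $\eta(\mathbf{x}) \geq M$ for all $\mathbf{x} \in \mathbb{Z}^d \setminus \{\mathbf{0}, \mathbf{y}\}$, and consider the two-type competing frog model on $\mathbb{Z}^d$ with laziness parameters $p_1, p_2$ and initial configuration $\eta$, started at time $0$ from one active type $1$ particle at $\mathbf{0}$ and one active type $2$ particle at $\mathbf{y}$, with any tie-breaking mechanism. Then coexistence occurs with positive probability, i.e. $\mathbb{P}_{\mathbf{0}, \mathbf{y}}(G_1 \cap G_2) > 0$.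
   Context: Two-type competing frog model on $\mathbb{Z}^d$ with laziness parameters $p_1,p_2\in(0,1]$: at time $0$ there is exactly one particle at $\mathbf{0}$, which is active and of type $1$, and exactly one particle at a site $\mathbf{y}\neq\mathbf{0}$, which is active and of type $2$; every other site $\mathbf{x}\in\mathbb{Z}^d\setminus\{\mathbf{0},\mathbf{y}\}$ contains $\eta(\mathbf{x})\in\{0,1,2,\dots\}$ dormant particles. Time is discrete. At each time step, independently of everything else, each active particle of type $i$ ($i=1,2$) stays at its present site with probability $1-p_i$, and with probability $p_i$ moves to a uniformly chosen one of the $2d$ nearest neighbours of its present site. Dormant particles do not move. When a site $\mathbf{x}\notin\{\mathbf{0},\mathbf{y}\}$ is first hit by active particle(s) (at time $n$, say), all dormant particles there become active at time $n$ (and make their first step between times $n$ and $n+1$). If all the particles arriving at $\mathbf{x}$ at that time have the same type $i$, the newly activated particles get type $i$. If particles of both types arrive at that time, the types of the newly activated particles are decided by a tie-breaking mechanism, i.e. an arbitrary fixed rule (deterministic, or using the history of the process up to time $n$ and additional independent randomness) assigning to each newly activated particle one of the types that arrived. Once active, a particle stays active and never changes type. $\mathbb{P}_{\mathbf{0},\mathbf{y}}$ denotes the law of this process. $N_n(i)$ is the set of active type $i$ particles at time $n$, $|N_n(i)|$ is its cardinality, and $G_i := \{|N_n(i)| \to \infty \text{ as } n \to \infty\}$ for $i=1,2$. Coexistence is the event $G_1\cap G_2$. *)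

theory Defs
  imports "HOL-Probability.Probability"
begin

datatype frog_type = Type1 | Type2

type_synonym 'd site = "int ^ 'd"

text \<open>The particle \<open>(x, k)\<close> is the \<open>k\<close>-th particle (counting from 0) initially placed at \<open>x\<close>.\<close>
type_synonym 'd particle = "'d site \<times> nat"

text \<open>
  In a state, \<open>Some (x, i)\<close> stands for an active particle of type \<open>i\<close> that is at \<open>x\<close>.
  \<open>None\<close> stands for a dormant particle, which is still at its initial site,
  and also for a label that belongs to no particle, such as \<open>(x, k)\<close> with \<open>k \<ge> \<eta> x\<close>.
\<close>
type_synonym 'd state = "'d particle \<Rightarrow> ('d site \<times> frog_type) option"

text \<open>
  A tie-breaking rule, applied at time \<open>n\<close>, is given the states at the times \<open>n - 1, \<dots>, 0\<close>
  (in this order), the state at time \<open>n\<close> after all moves but before the new activations,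
  and the value of the additional randomness; it proposes a type for every particle.
\<close>
type_synonym 'd tie_rule =
  "'d state list \<Rightarrow> 'd state \<Rightarrow> (nat \<Rightarrow> real) \<Rightarrow> 'd particle \<Rightarrow> frog_type"

definition unit_steps :: "'d::finite site set" where
  "unit_steps = {axis j s | j s. s \<in> {1, -1}}"

definition step_pmf :: "real \<Rightarrow> 'd::finite site pmf" where
  "step_pmf p = bind_pmf (bernoulli_pmf p)
     (\<lambda>moves. if moves then pmf_of_set unit_steps else return_pmf 0)"

definition initial_state :: "'d::finite site \<Rightarrow> 'd state" where
  "initial_state y = (\<lambda>a. if a = (0, 0) then Some (0, Type1)
                          else if a = (y, 0) then Some (y, Type2) else None)"

definition move :: "('d::finite particle \<Rightarrow> frog_type \<Rightarrow> 'd site) \<Rightarrow> 'd state \<Rightarrow> 'd state" where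
  "move \<xi> s = (\<lambda>a. map_option (\<lambda>(x, i). (x + \<xi> a i, i)) (s a))"

definition types_at :: "'d::finite state \<Rightarrow> 'd site \<Rightarrow> frog_type set" where
  "types_at s x = {i. \<exists>a. s a = Some (x, i)}"

text \<open>
  As long as \<open>x\<close> has dormant particles, it has not been hit before, so all active particles
  present at \<open>x\<close> after the moves have just arrived. The proposed types \<open>t\<close> matter only for ties.
\<close>
definition activate ::
  "'d::finite site \<Rightarrow> ('d site \<Rightarrow> nat) \<Rightarrow> ('d particle \<Rightarrow> frog_type) \<Rightarrow> 'd state \<Rightarrow> 'd state" where
  "activate y \<eta> t s = (\<lambda>(x, k). case s (x, k) of
       Some z \<Rightarrow> Some z
     | None \<Rightarrow>
         if x \<notin> {0, y} \<and> k < \<eta> x \<and> types_at s x \<noteq> {} then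
           Some (x, if types_at s x = {Type1} then Type1
                    else if types_at s x = {Type2} then Type2
                    else t (x, k))
         else None)"

text \<open>
  The step of an active particle \<open>a\<close> of type \<open>i\<close> between the times \<open>n\<close> and \<open>n + 1\<close> is the
  coordinate \<open>(a, n, i)\<close> of the first component of a sample point. All coordinates are
  independent, and each has the step law of its type. The second component is the additional
  randomness for the tie-breaking, independent of all the steps.
\<close>
type_synonym 'd sample = "('d particle \<times> nat \<times> frog_type \<Rightarrow> 'd site) \<times> (nat \<Rightarrow> real)"

definition frog_measure ::
  "real \<Rightarrow> real \<Rightarrow> (nat \<Rightarrow> real) measure \<Rightarrow> 'd::finite sample measure" where
  "frog_measure p1 p2 R =
     PiM UNIV (\<lambda>(a, n, i). measure_pmf (step_pmf (case i of Type1 \<Rightarrow> p1 | Type2 \<Rightarrow> p2)))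
       \<Otimes>\<^sub>M R"

text \<open>The states at the times \<open>n, \<dots>, 0\<close>, in this order.\<close>
primrec history ::
  "'d::finite site \<Rightarrow> ('d site \<Rightarrow> nat) \<Rightarrow> 'd tie_rule \<Rightarrow> 'd sample \<Rightarrow> nat \<Rightarrow> 'd state list" where
  "history y \<eta> tb \<omega> 0 = [initial_state y]"
| "history y \<eta> tb \<omega> (Suc n) =
     (let h = history y \<eta> tb \<omega> n;
          s = move (\<lambda>a i. fst \<omega> (a, n, i)) (hd h)
      in activate y \<eta> (tb h s (snd \<omega>)) s # h)"

definition active_set ::
  "'d::finite site \<Rightarrow> ('d site \<Rightarrow> nat) \<Rightarrow> 'd tie_rule \<Rightarrow> frog_type \<Rightarrow> 'd sample \<Rightarrow> nat \<Rightarrow> 'd particle set"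
  where
  "active_set y \<eta> tb i \<omega> n = {a. \<exists>x. hd (history y \<eta> tb \<omega> n) a = Some (x, i)}"

text \<open>
  The randomness may have any law on sequences of reals. Only countably many histories are
  possible, so measurability for each fixed history suffices for the process to be measurable.
\<close>
definition tie_breaking :: "(nat \<Rightarrow> real) measure \<Rightarrow> 'd::finite tie_rule \<Rightarrow> bool" where
  "tie_breaking R tb \<longleftrightarrow> prob_space R \<and>
     (\<forall>h s a. (\<lambda>u. tb h s u a) \<in> measurable R (count_space UNIV))"

definition G_event ::
  "real \<Rightarrow> real \<Rightarrow> (nat \<Rightarrow> real) measure \<Rightarrow> 'd::finite site \<Rightarrow> ('d site \<Rightarrow> nat) \<Rightarrow> 'd tie_rule
     \<Rightarrow> frog_type \<Rightarrow> 'd sample set" where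
  "G_event p1 p2 R y \<eta> tb i = {\<omega> \<in> space (frog_measure p1 p2 R).
     filterlim (\<lambda>n. card (active_set y \<eta> tb i \<omega> n)) at_top sequentially}"

end

theory Submission
  imports Defs
begin

text \<open>
  Steps have length at most 1 in the \<open>\<ell>\<^sup>1\<close>-norm, so a site at distance \<open>n\<close> from one starting point and
  farther than \<open>n\<close> from the other one gets the type of the nearer starting point if it is reached at
  time \<open>n\<close>. Choose two coordinate axes and two quadrants, one at \<open>0\<close> and one at \<open>y\<close>, that point away
  from each other: along monotone paths in its own quadrant, each type is never disturbed by the other.
  There, activation times are known in advance, and a type survives as soon as directed bond
  percolation on its quadrant has an infinite cluster, where a bond is open if some particle of a
  block of \<open>m\<close> particles at its tail uses it in its first step. A finite cluster has a closed boundary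
  walk of some length \<open>2n\<close>; as the walk returns to its start, exactly \<open>n\<close> of its edges run north or
  west, and these belong to \<open>n\<close> different closed bonds. There are at most \<open>16\<^sup>n\<close> such walks, and each of them
  has probability at most \<open>64\<^sup>-\<^sup>n\<close> when \<open>m\<close> is large, which leaves positive probability that both clusters
  are infinite.
\<close>

section \<open>Boundary walks of finite clusters\<close>

datatype direction = East | North | West | South

fun displacement :: "direction \<Rightarrow> int \<times> int" where
  "displacement East = (1, 0)"
| "displacement North = (0, 1)"
| "displacement West = (-1, 0)"
| "displacement South = (0, -1)"

fun turn_left :: "direction \<Rightarrow> direction" where
  "turn_left East = North"
| "turn_left North = West"
| "turn_left West = South"
| "turn_left South = East"

fun turn_right :: "direction \<Rightarrow> direction" where
  "turn_right East = South"
| "turn_right North = East"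
| "turn_right West = North"
| "turn_right South = West"

text \<open>The cell \<open>(a, b)\<close> is the unit square with lower left corner \<open>(a, b)\<close>.\<close>
fun left_cell :: "(int \<times> int) \<times> direction \<Rightarrow> int \<times> int" where
  "left_cell ((a, b), East) = (a, b)"
| "left_cell ((a, b), North) = (a - 1, b)"
| "left_cell ((a, b), West) = (a - 1, b - 1)"
| "left_cell ((a, b), South) = (a, b - 1)"

fun right_cell :: "(int \<times> int) \<times> direction \<Rightarrow> int \<times> int" where
  "right_cell ((a, b), East) = (a, b - 1)"
| "right_cell ((a, b), North) = (a, b)"
| "right_cell ((a, b), West) = (a - 1, b)"
| "right_cell ((a, b), South) = (a - 1, b - 1)"

definition boundary :: "(int \<times> int) set \<Rightarrow> ((int \<times> int) \<times> direction) set" where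
  "boundary C = {e. left_cell e \<in> C \<and> right_cell e \<notin> C}"

definition next_edge :: "(int \<times> int) set \<Rightarrow> (int \<times> int) \<times> direction \<Rightarrow> (int \<times> int) \<times> direction" where
  "next_edge C = (\<lambda>(v, u). let v' = v + displacement u in
     (v', if left_cell (v', u) \<notin> C then turn_left u
          else if right_cell (v', u) \<notin> C then u else turn_right u))"

lemma next_edge_in_boundary:
  assumes "e \<in> boundary C" shows "next_edge C e \<in> boundary C"
proof -
  obtain a b u where "e = ((a, b), u)" by (metis surj_pair)
  then show ?thesis
    using assms by (cases u) (auto simp: boundary_def next_edge_def Let_def)
qed

lemma inj_on_next_edge: "inj_on (next_edge C) (boundary C)"
proof (rule inj_onI)
  fix e f assume *: "e \<in> boundary C" "f \<in> boundary C" "next_edge C e = next_edge C f"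
  obtain a b u where e: "e = ((a, b), u)" by (metis surj_pair)
  obtain a' b' u' where f: "f = ((a', b'), u')" by (metis surj_pair)
  show "e = f"
    using * unfolding e f
    by (cases u; cases u')
      (auto simp: boundary_def next_edge_def Let_def add.commute split: if_splits)
qed

lemma finite_boundary:
  assumes "finite C" shows "finite (boundary C)"
proof (rule finite_imageD)
  have "finite (UNIV :: direction set)"
  proof -
    have "(UNIV :: direction set) = {East, North, West, South}"
      using direction.exhaust by auto
    then show ?thesis using finite.simps by auto
  qed
  with assms show "finite ((\<lambda>e. (left_cell e, snd e)) ` boundary C)"
    by (elim finite_subset[OF _ finite_cartesian_product, rotated]) (auto simp: boundary_def)
  show "inj_on (\<lambda>e. (left_cell e, snd e)) (boundary C)"
  proof (rule inj_onI)
    fix e f :: "(int \<times> int) \<times> direction"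
    assume *: "(left_cell e, snd e) = (left_cell f, snd f)"
    obtain a b u where e: "e = ((a, b), u)" by (metis surj_pair)
    obtain a' b' u' where f: "f = ((a', b'), u')" by (metis surj_pair)
    show "e = f"
      using * unfolding e f by (cases u; cases u') auto
  qed
qed

lemma orbit_cycle:
  assumes fin: "finite B" and inj: "inj_on f B" and closed: "\<And>x. x \<in> B \<Longrightarrow> f x \<in> B"
    and x: "x \<in> B"
  obtains l where "l > 0" "(f ^^ l) x = x" "inj_on (\<lambda>i. (f ^^ i) x) {..<l}"
proof -
  have in_B: "(f ^^ i) x \<in> B" for i
    by (induction i) (auto simp: x closed)
  have cancel: "(f ^^ k) x = x" if "(f ^^ (i + k)) x = (f ^^ i) x" for i k
    using that
  proof (induction i)
    case (Suc i)
    then have "f ((f ^^ (i + k)) x) = f ((f ^^ i) x)" by simp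
    then have "(f ^^ (i + k)) x = (f ^^ i) x"
      using inj in_B by (meson inj_onD)
    then show ?case by (rule Suc.IH)
  qed simp
  have "\<not> inj_on (\<lambda>i. (f ^^ i) x) (UNIV :: nat set)"
  proof
    assume "inj_on (\<lambda>i. (f ^^ i) x) (UNIV :: nat set)"
    moreover have "finite (range (\<lambda>i. (f ^^ i) x))"
      by (rule finite_subset[OF _ fin]) (use in_B in auto)
    ultimately show False
      using finite_imageD infinite_UNIV_nat by blast
  qed
  then obtain i j where "i \<noteq> j" "(f ^^ i) x = (f ^^ j) x"
    unfolding inj_on_def by blast
  then have "\<exists>i j. i < j \<and> (f ^^ j) x = (f ^^ i) x"
    by (metis linorder_neqE_nat)
  then obtain i j where ij: "i < j" "(f ^^ j) x = (f ^^ i) x" by blast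
  then have "(f ^^ (j - i)) x = x"
    by (intro cancel[of i]) simp
  with ij have "\<exists>l>0. (f ^^ l) x = x"
    by (intro exI[of _ "j - i"]) simp
  define l where "l = (LEAST l. l > 0 \<and> (f ^^ l) x = x)"
  have l: "l > 0" "(f ^^ l) x = x"
    using LeastI_ex[OF \<open>\<exists>l>0. (f ^^ l) x = x\<close>] unfolding l_def by auto
  have min: "(f ^^ k) x \<noteq> x" if "k > 0" "k < l" for k
    using that not_less_Least[of k "\<lambda>l. l > 0 \<and> (f ^^ l) x = x"] unfolding l_def by auto
  have less: "(f ^^ i) x \<noteq> (f ^^ j) x" if "i < j" "j < l" for i j
  proof
    assume "(f ^^ i) x = (f ^^ j) x"
    then have "(f ^^ (j - i)) x = x"
      using that by (intro cancel[of i]) simp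
    moreover have "j - i > 0" "j - i < l" using that by arith+
    ultimately show False using min by blast
  qed
  have "inj_on (\<lambda>i. (f ^^ i) x) {..<l}"
  proof (rule inj_onI)
    fix i j assume "i \<in> {..<l}" "j \<in> {..<l}" "(f ^^ i) x = (f ^^ j) x"
    then show "i = j"
      using less[of i j] less[of j i] by (cases i j rule: linorder_cases) auto
  qed
  with l that show ?thesis by blast
qed

definition walk_edge :: "direction list \<Rightarrow> nat \<Rightarrow> (int \<times> int) \<times> direction" where
  "walk_edge w i = ((\<Sum>j<i. displacement (w ! j)), w ! i)"

text \<open>
  With the cluster on its left, a walk along its boundary moves north or west exactly when it
  separates a cell of the cluster from the cell to its right or from the cell above it.
\<close>
definition crossings :: "direction list \<Rightarrow> ((int \<times> int) \<times> direction) set" where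
  "crossings w = {walk_edge w i | i. i < length w \<and> w ! i \<in> {North, West}}"

lemma peierls_contour:
  assumes fin: "finite C" and "(0, 0) \<in> C" "(0, -1) \<notin> C"
  obtains c w where "c > 0" "length w = 2 * c" "card (crossings w) = c" "crossings w \<subseteq> boundary C"
proof -
  define e0 where "e0 = ((0, 0) :: int \<times> int, East)"
  have "e0 \<in> boundary C"
    using assms by (auto simp: boundary_def e0_def)
  then obtain l where l: "l > 0" "(next_edge C ^^ l) e0 = e0"
      "inj_on (\<lambda>i. (next_edge C ^^ i) e0) {..<l}"
    using orbit_cycle[OF finite_boundary[OF fin] inj_on_next_edge next_edge_in_boundary] by blast
  define orb where "orb i = (next_edge C ^^ i) e0" for i
  have orb_in: "orb i \<in> boundary C" for i
    unfolding orb_def by (induction i) (auto simp: \<open>e0 \<in> boundary C\<close> next_edge_in_boundary)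
  have orb_fst: "fst (orb i) = (\<Sum>j<i. displacement (snd (orb j)))" for i
  proof (induction i)
    case 0
    then show ?case by (simp add: orb_def e0_def zero_prod_def)
  next
    case (Suc i)
    have "fst (orb (Suc i)) = fst (orb i) + displacement (snd (orb i))"
      by (simp add: orb_def next_edge_def case_prod_beta Let_def)
    then show ?case by (simp add: Suc)
  qed
  define w where "w = map (\<lambda>i. snd (orb i)) [0..<l]"
  have w_nth: "w ! i = snd (orb i)" if "i < l" for i
    using that by (simp add: w_def)
  have len: "length w = l" by (simp add: w_def)
  have walk: "walk_edge w i = orb i" if "i < l" for i
  proof -
    have "(\<Sum>j<i. displacement (w ! j)) = (\<Sum>j<i. displacement (snd (orb j)))"
      using that by (intro sum.cong) (auto simp: w_nth)
    then show ?thesis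
      using that by (simp add: walk_edge_def w_nth flip: orb_fst)
  qed
  define I where "I D = {i. i < l \<and> snd (orb i) = D}" for D
  have fin_I: "finite (I D)" for D unfolding I_def by simp
  have "(\<Sum>j<l. displacement (snd (orb j))) = 0"
    using l(2) by (simp flip: orb_fst) (simp add: orb_def e0_def zero_prod_def)
  then have 0: "(\<Sum>j<l. fst (displacement (snd (orb j)))) = 0"
      "(\<Sum>j<l. snd (displacement (snd (orb j)))) = 0"
    by (metis fst_sum fst_zero, metis snd_sum snd_zero)
  have card_I: "int (card (I D)) = (\<Sum>j<l. if snd (orb j) = D then 1 else 0)" for D
    by (simp add: I_def sum.If_cases Int_def lessThan_def)
  have "fst (displacement D) = (if D = East then 1 else 0) - (if D = West then 1 else 0)"
    "snd (displacement D) = (if D = North then 1 else 0) - (if D = South then 1 else 0)" for D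
    by (cases D; simp)+
  with 0 have eq: "card (I East) = card (I West)" "card (I North) = card (I South)"
    by (simp_all add: sum_subtractf flip: card_I)
  have "int l = (\<Sum>j<l. 1)" by simp
  also have "\<dots> = (\<Sum>j<l. (if snd (orb j) = East then 1 else 0) + (if snd (orb j) = West then 1 else 0)
      + (if snd (orb j) = North then 1 else 0) + (if snd (orb j) = South then 1 else 0))"
  proof (rule sum.cong)
    fix j show "1 = (if snd (orb j) = East then 1 else 0) + (if snd (orb j) = West then 1 else 0)
      + (if snd (orb j) = North then 1 else 0) + (if snd (orb j) = South then 1 else (0::int))"
      by (cases "snd (orb j)") auto
  qed simp
  also have "\<dots> = int (card (I East) + card (I West) + card (I North) + card (I South))"
    by (simp add: sum.distrib flip: card_I)
  finally have l_eq: "l = 2 * (card (I North) + card (I West))"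
    using eq by simp
  have "crossings w = walk_edge w ` {i. i < l \<and> w ! i \<in> {North, West}}"
    by (auto simp: crossings_def len)
  also have "{i. i < l \<and> w ! i \<in> {North, West}} = I North \<union> I West"
    by (auto simp: I_def w_nth)
  also have "walk_edge w ` (I North \<union> I West) = orb ` (I North \<union> I West)"
    by (intro image_cong) (auto simp: I_def walk)
  finally have "crossings w = orb ` (I North \<union> I West)" .
  moreover have "inj_on orb (I North \<union> I West)"
    using l(3) unfolding orb_def by (rule inj_on_subset) (auto simp: I_def)
  moreover have "card (I North \<union> I West) = card (I North) + card (I West)"
    by (intro card_Un_disjoint fin_I) (auto simp: I_def)
  ultimately have "card (crossings w) = card (I North) + card (I West)" "crossings w \<subseteq> boundary C"
    using orb_in by (auto simp: card_image)
  then show ?thesis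
    using l_eq l(1) len by (intro that[of "card (I North) + card (I West)" w]) auto
qed

section \<open>Speed, persistence and activation\<close>

definition norm_l1 :: "'d::finite site \<Rightarrow> int" where
  "norm_l1 x = (\<Sum>i\<in>UNIV. \<bar>x $ i\<bar>)"

lemma norm_l1_0 [simp]: "norm_l1 0 = 0"
  by (simp add: norm_l1_def)

lemma norm_l1_pos: "x \<noteq> 0 \<Longrightarrow> norm_l1 x > 0"
  unfolding norm_l1_def by (subst sum_nonneg_eq_0_iff order.strict_iff_order)+
    (auto simp: vec_eq_iff sum_nonneg sum_nonneg_eq_0_iff)

lemma norm_l1_minus [simp]: "norm_l1 (- x) = norm_l1 x"
  by (simp add: norm_l1_def)

lemma norm_l1_triangle: "norm_l1 (x + y) \<le> norm_l1 x + norm_l1 y"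
  unfolding norm_l1_def by (simp flip: sum.distrib) (intro sum_mono abs_triangle_ineq)

lemma norm_l1_add_axis:
  assumes "\<bar>\<sigma>\<bar> = 1" "0 \<le> \<sigma> * x $ j" "0 \<le> s"
  shows "norm_l1 (x + axis j (\<sigma> * s)) = norm_l1 x + s"
proof -
  have *: "\<bar>x $ j + \<sigma> * s\<bar> = \<bar>x $ j\<bar> + s"
  proof -
    have "\<sigma> = 1 \<or> \<sigma> = - 1" using assms(1) by auto
    then show ?thesis using assms by auto
  qed
  have "norm_l1 (x + axis j (\<sigma> * s)) = (\<Sum>i\<in>UNIV. \<bar>x $ i\<bar> + (if i = j then s else 0))"
    unfolding norm_l1_def by (intro sum.cong) (auto simp: axis_def *)
  then show ?thesis by (simp add: sum.distrib norm_l1_def)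
qed

abbreviation state_at where
  "state_at y \<eta> tb \<omega> n \<equiv> hd (history y \<eta> tb \<omega> n)"

abbreviation moved_state where
  "moved_state y \<eta> tb \<omega> n \<equiv> move (\<lambda>a i. fst \<omega> (a, n, i)) (state_at y \<eta> tb \<omega> n)"

fun origin :: "'d::finite site \<Rightarrow> frog_type \<Rightarrow> 'd site" where
  "origin y Type1 = 0"
| "origin y Type2 = y"

lemma state_at_Suc:
  "state_at y \<eta> tb \<omega> (Suc n) =
     activate y \<eta> (tb (history y \<eta> tb \<omega> n) (moved_state y \<eta> tb \<omega> n) (snd \<omega>)) (moved_state y \<eta> tb \<omega> n)"
  by (simp add: Let_def)

lemma move_eq_Some_iff:
  "move \<xi> s a = Some (x, i) \<longleftrightarrow> (\<exists>x'. s a = Some (x', i) \<and> x = x' + \<xi> a i)"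
  by (auto simp: move_def split: option.splits)

lemma activate_Some: "s a = Some z \<Longrightarrow> activate y \<eta> t s a = Some z"
  by (cases a) (simp add: activate_def)

lemma frog_type_set_cases:
  fixes T :: "frog_type set"
  assumes "T \<noteq> {}" "T \<noteq> {Type1}" "T \<noteq> {Type2}"
  shows "T = UNIV"
proof -
  have "Type1 \<in> T" "Type2 \<in> T"
    using assms by (metis (full_types) ex_in_conv frog_type.exhaust subsetI subset_singletonD singleton_iff)+
  then show ?thesis using frog_type.exhaust by (metis (full_types) UNIV_eq_I)
qed

lemma activate_eq_SomeD:
  assumes "activate y \<eta> t s (x, k) = Some (z, i)" "s (x, k) = None"
  shows "z = x" "i \<in> types_at s x" "k < \<eta> x"
proof -
  have *: "x \<notin> {0, y} \<and> k < \<eta> x \<and> types_at s x \<noteq> {}"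
    using assms by (auto simp: activate_def split: if_splits)
  then show "z = x" "k < \<eta> x"
    using assms by (auto simp: activate_def split: if_splits)
  show "i \<in> types_at s x"
    using * assms frog_type_set_cases[of "types_at s x"]
    by (auto simp: activate_def split: if_splits)
qed

lemma state_at_persistent:
  assumes "state_at y \<eta> tb \<omega> m a = Some (x, i)" "m \<le> n"
  shows "\<exists>x'. state_at y \<eta> tb \<omega> n a = Some (x', i)"
  using assms(2)
proof (induction n rule: dec_induct)
  case (step n)
  then obtain x' where "state_at y \<eta> tb \<omega> n a = Some (x', i)" by blast
  then have "moved_state y \<eta> tb \<omega> n a = Some (x' + fst \<omega> (a, n, i), i)"
    by (simp add: move_eq_Some_iff)
  then show ?case
    unfolding state_at_Suc by (blast intro: activate_Some)
qed (use assms in simp)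

lemma dom_move [simp]: "dom (move \<xi> s) = dom s"
  by (auto simp: move_def)

lemma finite_dom_activate:
  assumes "finite (dom s)" shows "finite (dom (activate y \<eta> t s))"
proof -
  define X where "X = (\<lambda>a. fst (the (s a))) ` dom s"
  have X: "x \<in> X" if "i \<in> types_at s x" for x i
    using that unfolding types_at_def X_def by force
  have "dom (activate y \<eta> t s) \<subseteq> dom s \<union> (SIGMA x:X. {..<\<eta> x})"
  proof
    fix a assume "a \<in> dom (activate y \<eta> t s)"
    then obtain x k z i where *: "a = (x, k)" "activate y \<eta> t s (x, k) = Some (z, i)"
      by (cases a) auto
    show "a \<in> dom s \<union> (SIGMA x:X. {..<\<eta> x})"
    proof (cases "s (x, k)")
      case None
      with activate_eq_SomeD[OF *(2) None] X show ?thesis by (auto simp: *(1))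
    qed (auto simp: *(1))
  qed
  moreover have "finite (dom s \<union> (SIGMA x:X. {..<\<eta> x}))"
    using assms by (intro finite_UnI finite_SigmaI) (auto simp: X_def)
  ultimately show ?thesis by (rule finite_subset)
qed

lemma finite_dom_initial_state: "finite (dom (initial_state y))"
  by (rule finite_subset[of _ "{(0, 0), (y, 0)}"]) (auto simp: initial_state_def split: if_splits)

lemma finite_dom_state_at: "finite (dom (state_at y \<eta> tb \<omega> n))"
proof (induction n)
  case (Suc n)
  then show ?case
    unfolding state_at_Suc by (intro finite_dom_activate) simp
qed (simp add: finite_dom_initial_state)

context
  fixes y :: "'d::finite site" and \<eta> :: "'d site \<Rightarrow> nat" and tb :: "'d tie_rule"
    and \<omega> :: "'d sample"
  assumes unit_speed: "\<And>a n i. norm_l1 (fst \<omega> (a, n, i)) \<le> 1"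
begin

lemma moved_norm_le:
  assumes "\<And>a x i. state_at y \<eta> tb \<omega> n a = Some (x, i) \<Longrightarrow> norm_l1 (x - origin y i) \<le> int n"
    and "moved_state y \<eta> tb \<omega> n a = Some (x, i)"
  shows "norm_l1 (x - origin y i) \<le> int (Suc n)"
proof -
  obtain x' where x': "state_at y \<eta> tb \<omega> n a = Some (x', i)" "x = x' + fst \<omega> (a, n, i)"
    using assms(2) by (auto simp: move_eq_Some_iff)
  have "norm_l1 (x - origin y i) \<le> norm_l1 (x' - origin y i) + norm_l1 (fst \<omega> (a, n, i))"
    using norm_l1_triangle[of "x' - origin y i" "fst \<omega> (a, n, i)"] by (simp add: x' algebra_simps)
  with assms(1)[OF x'(1)] unit_speed[of a n i] show ?thesis by simp
qed

lemma state_at_norm_le: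
  "state_at y \<eta> tb \<omega> n a = Some (x, i) \<Longrightarrow> norm_l1 (x - origin y i) \<le> int n"
proof (induction n arbitrary: a x i)
  case 0
  then show ?case by (auto simp: initial_state_def split: if_splits)
next
  case (Suc n)
  note moved = moved_norm_le[OF Suc.IH]
  obtain x0 k where a: "a = (x0, k)" by force
  show ?case
  proof (cases "moved_state y \<eta> tb \<omega> n a")
    case None
    have "x = x0" "i \<in> types_at (moved_state y \<eta> tb \<omega> n) x0"
      using activate_eq_SomeD[of y \<eta> _ _ x0 k x i] Suc.prems None unfolding state_at_Suc a by blast+
    then show ?thesis unfolding types_at_def using moved by auto
  next
    case (Some z)
    then have "state_at y \<eta> tb \<omega> (Suc n) a = Some z"
      unfolding state_at_Suc by (rule activate_Some)
    with Suc.prems Some show ?thesis using moved by simp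
  qed
qed

lemma moved_state_norm_le:
  "moved_state y \<eta> tb \<omega> n a = Some (x, i) \<Longrightarrow> norm_l1 (x - origin y i) \<le> int (Suc n)"
  using moved_norm_le state_at_norm_le by blast

lemma activated_norm_le:
  assumes "state_at y \<eta> tb \<omega> n (x, k) \<noteq> None"
  shows "\<exists>i. norm_l1 (x - origin y i) \<le> int n"
  using assms
proof (induction n)
  case 0
  then have "x = origin y Type1 \<or> x = origin y Type2"
    by (auto simp: initial_state_def split: if_splits)
  then show ?case by (metis norm_l1_0 cancel_comm_monoid_add_class.diff_cancel of_nat_0 order_refl)
next
  case (Suc n)
  show ?case
  proof (cases "state_at y \<eta> tb \<omega> n (x, k)")
    case None
    then have "moved_state y \<eta> tb \<omega> n (x, k) = None" by (simp add: move_def)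
    moreover obtain z i where "state_at y \<eta> tb \<omega> (Suc n) (x, k) = Some (z, i)"
      using Suc.prems by auto
    ultimately have "i \<in> types_at (moved_state y \<eta> tb \<omega> n) x"
      unfolding state_at_Suc by (metis activate_eq_SomeD(2))
    then show ?thesis unfolding types_at_def using moved_state_norm_le by blast
  next
    case (Some z)
    then obtain i where "norm_l1 (x - origin y i) \<le> int n"
      using Suc.IH by auto
    then show ?thesis by (intro exI[of _ i]) simp
  qed
qed

text \<open>
  A type \<open>i\<close> particle that arrives at \<open>x\<close> at the earliest possible time meets no particle of the
  other type, as that type cannot have reached \<open>x\<close> yet.
\<close>
lemma activation_at_geodesic_time:
  assumes "state_at y \<eta> tb \<omega> n a = Some (x', i)" "x' + fst \<omega> (a, n, i) = x"
    and "norm_l1 (x - origin y i) = int (Suc n)"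
    and other: "\<And>j. j \<noteq> i \<Longrightarrow> norm_l1 (x - origin y j) > int (Suc n)"
    and "k < \<eta> x"
  shows "state_at y \<eta> tb \<omega> (Suc n) (x, k) = Some (x, i)"
proof -
  let ?s = "moved_state y \<eta> tb \<omega> n"
  have far: "norm_l1 (x - origin y j) \<ge> int (Suc n)" for j
    using assms(3) other[of j] by (cases "j = i") auto
  have "state_at y \<eta> tb \<omega> n (x, k) = None"
    using activated_norm_le[of n x k] far by (metis int_Suc linorder_not_less order_trans zless_iff_Suc_zadd
        less_add_one order_less_le_trans)
  then have none: "?s (x, k) = None" by (simp add: move_def)
  have "?s a = Some (x, i)" using assms(1,2) by (simp add: move_eq_Some_iff)
  then have "i \<in> types_at ?s x" unfolding types_at_def by blast
  moreover have "j = i" if "j \<in> types_at ?s x" for j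
  proof -
    from that obtain b where "?s b = Some (x, j)" unfolding types_at_def by blast
    then have "norm_l1 (x - origin y j) \<le> int (Suc n)" by (rule moved_state_norm_le)
    then show ?thesis using other[of j] by (cases "j = i") auto
  qed
  ultimately have types: "types_at ?s x = {i}" by blast
  have "x \<noteq> origin y j" for j
    using far[of j] by (cases "x = origin y j") auto
  from this[of Type1] this[of Type2] have "x \<notin> {0, y}" by simp
  then show ?thesis
    unfolding state_at_Suc using types none \<open>k < \<eta> x\<close> by (cases i) (simp_all add: activate_def)
qed

end

section \<open>Measurability of survival\<close>

instance frog_type :: countable
  by countable_datatype

definition finite_states :: "'d::finite state set" where
  "finite_states = {s. finite (dom s)}"

lemma countable_finite_states: "countable (finite_states :: 'd::finite state set)"
proof -
  have "countable (Map.graph ` (finite_states :: 'd state set))"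
    by (rule countable_subset[OF _ countable_Collect_finite])
      (auto simp: finite_states_def graph_eq_to_snd_dom)
  moreover have "inj_on Map.graph (finite_states :: 'd state set)"
  proof (rule inj_onI)
    fix s t :: "'d state" assume eq: "Map.graph s = Map.graph t"
    show "s = t"
    proof
      fix a
      have "s a = Some b \<longleftrightarrow> t a = Some b" for b
      proof -
        have "(a, b) \<in> Map.graph s \<longleftrightarrow> (a, b) \<in> Map.graph t"
          using eq by simp
        then show ?thesis unfolding Map.graph_def by blast
      qed
      then show "s a = t a" by (metis not_None_eq)
    qed
  qed
  ultimately show ?thesis by (rule countable_image_inj_on)
qed

lemma measurable_finite_states:
  assumes "\<And>\<omega>. \<omega> \<in> space M \<Longrightarrow> f \<omega> \<in> finite_states"
    and "\<And>a. (\<lambda>\<omega>. f \<omega> a) \<in> measurable M (count_space UNIV)"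
  shows "f \<in> measurable M (count_space (finite_states :: 'd::finite state set))"
  unfolding measurable_count_space_eq_countable[OF countable_finite_states]
proof (intro conjI ballI)
  fix s :: "'d state"
  have "f -` {s} \<inter> space M = {\<omega> \<in> space M. \<forall>a. f \<omega> a = s a}"
    by (auto simp: fun_eq_iff)
  also have "\<dots> \<in> sets M"
    using assms(2) by measurable
  finally show "f -` {s} \<inter> space M \<in> sets M" .
qed (use assms(1) in auto)

lemma measurable_step [measurable]:
  "(\<lambda>\<omega>. fst \<omega> c) \<in> measurable (frog_measure p1 p2 R) (count_space UNIV)"
proof -
  have "(\<lambda>\<xi>. \<xi> c) \<in> measurable (PiM UNIV (\<lambda>(a, n, i). measure_pmf (step_pmf (case i of Type1 \<Rightarrow> p1 | Type2 \<Rightarrow> p2))))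
     ((\<lambda>(a, n, i). measure_pmf (step_pmf (case i of Type1 \<Rightarrow> p1 | Type2 \<Rightarrow> p2))) c)"
    by (rule measurable_component_singleton) simp
  then have "(\<lambda>\<xi>. \<xi> c) \<in> measurable (PiM UNIV (\<lambda>(a, n, i). measure_pmf (step_pmf (case i of Type1 \<Rightarrow> p1 | Type2 \<Rightarrow> p2))))
     (count_space UNIV)"
    by (simp add: case_prod_beta)
  then show ?thesis
    unfolding frog_measure_def by (rule measurable_compose[OF measurable_fst])
qed

lemma measurable_move:
  assumes "s \<in> finite_states"
  shows "(\<lambda>\<omega>. move (\<lambda>a i. fst \<omega> (a, n, i)) s) \<in> measurable (frog_measure p1 p2 R) (count_space finite_states)"
proof (rule measurable_finite_states)
  fix a
  show "(\<lambda>\<omega>. move (\<lambda>a i. fst \<omega> (a, n, i)) s a) \<in> measurable (frog_measure p1 p2 R) (count_space UNIV)"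
  proof (cases "s a")
    case None
    then show ?thesis by (simp add: move_def)
  next
    case (Some z)
    have "(\<lambda>\<omega>. Some (fst z + fst \<omega> (a, n, snd z), snd z))
        \<in> measurable (frog_measure p1 p2 R) (count_space UNIV)"
      by (rule measurable_compose[OF measurable_step]) simp
    with Some show ?thesis by (simp add: move_def case_prod_beta)
  qed
qed (use assms in \<open>simp add: finite_states_def\<close>)

lemma measurable_activate:
  assumes "tie_breaking R tb" "s \<in> finite_states"
  shows "(\<lambda>\<omega>. activate y \<eta> (tb h s (snd \<omega>)) s)
    \<in> measurable (frog_measure p1 p2 R) (count_space finite_states)"
proof (rule measurable_finite_states)
  fix a
  define g where "g t = activate y \<eta> (\<lambda>_. t) s a" for t
  have "(\<lambda>u. tb h s u a) \<in> measurable R (count_space UNIV)"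
    using assms(1) unfolding tie_breaking_def by blast
  then have "(\<lambda>\<omega>. tb h s (snd \<omega>) a) \<in> measurable (frog_measure p1 p2 R) (count_space UNIV)"
    unfolding frog_measure_def by (rule measurable_compose[OF measurable_snd])
  then have "(\<lambda>\<omega>. g (tb h s (snd \<omega>) a)) \<in> measurable (frog_measure p1 p2 R) (count_space UNIV)"
    by (rule measurable_compose) simp
  moreover have "activate y \<eta> t s a = g (t a)" for t
    by (cases a) (simp add: g_def activate_def)
  ultimately show "(\<lambda>\<omega>. activate y \<eta> (tb h s (snd \<omega>)) s a)
      \<in> measurable (frog_measure p1 p2 R) (count_space UNIV)"
    by simp
qed (use assms in \<open>simp add: finite_states_def finite_dom_activate\<close>)

lemma measurable_history:
  fixes y :: "'d::finite site"
  assumes "tie_breaking R tb"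
  shows "(\<lambda>\<omega>. history y \<eta> tb \<omega> n)
    \<in> measurable (frog_measure p1 p2 R) (count_space (lists finite_states - {[]}))"
    (is "_ \<in> measurable ?M (count_space ?H)")
proof (induction n)
  case 0
  show ?case by (simp add: finite_states_def finite_dom_initial_state)
next
  case (Suc n)
  have H: "countable ?H"
    by (intro countable_Diff countable_lists countable_finite_states)
  define F where "F h \<omega> = (let s = move (\<lambda>a i. fst \<omega> (a, n, i)) (hd h)
      in activate y \<eta> (tb h s (snd \<omega>)) s # h)" for h \<omega>
  have "F h \<in> measurable ?M (count_space ?H)" if h: "h \<in> ?H" for h
  proof -
    have hd: "hd h \<in> finite_states" using h by (cases h) auto
    have "(\<lambda>\<omega>. activate y \<eta> (tb h (move (\<lambda>a i. fst \<omega> (a, n, i)) (hd h)) (snd \<omega>))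
        (move (\<lambda>a i. fst \<omega> (a, n, i)) (hd h))) \<in> measurable ?M (count_space finite_states)"
      by (rule measurable_compose_countable'[OF measurable_activate[OF assms]
            measurable_move[OF hd] countable_finite_states])
    moreover have "(\<lambda>s. s # h) \<in> measurable (count_space finite_states) (count_space ?H)"
      using h by auto
    ultimately show ?thesis
      unfolding F_def Let_def by (rule measurable_compose)
  qed
  from measurable_compose_countable'[OF this Suc H] show ?case
    by (simp add: F_def Let_def)
qed

lemma measurable_G_event [measurable]:
  assumes "tie_breaking R tb"
  shows "G_event p1 p2 R y \<eta> tb i \<in> sets (frog_measure p1 p2 R)"
proof -
  have [measurable]: "(\<lambda>\<omega>. card (active_set y \<eta> tb i \<omega> n))
      \<in> measurable (frog_measure p1 p2 R) (count_space UNIV)" for n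
    unfolding active_set_def
    by (rule measurable_compose[OF measurable_history[OF assms]]) simp
  show ?thesis
    unfolding G_event_def filterlim_at_top eventually_sequentially by measurable
qed

section \<open>Two opposite quadrants\<close>

fun side :: "frog_type \<Rightarrow> int" where
  "side Type1 = -1"
| "side Type2 = 1"

text \<open>
  \<open>block m North\<close> and \<open>block m West\<close> are disjoint, so that different boundary edges of a cluster
  involve different particles.
\<close>
definition block :: "nat \<Rightarrow> direction \<Rightarrow> nat set" where
  "block m u = (if u = North then {..<m} else {m..<2 * m})"

locale opposite_quadrants =
  fixes y :: "'d::finite site" and j k :: 'd and \<sigma> \<tau> :: int
  assumes axes: "j \<noteq> k"
    and sign_j: "\<bar>\<sigma>\<bar> = 1" "\<sigma> * y $ j > 0"
    and sign_k: "\<bar>\<tau>\<bar> = 1" "\<tau> * y $ k \<ge> 0"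
begin

definition quadrant_step :: "frog_type \<Rightarrow> direction \<Rightarrow> 'd site" where
  "quadrant_step i u = (if u = North then axis j (side i * \<sigma>) else axis k (side i * \<tau>))"

text \<open>
  The cell \<open>(0, 0)\<close> is one step away from the starting point, whose single particle cannot open
  a bond with high probability.
\<close>
definition quadrant_site :: "frog_type \<Rightarrow> int \<times> int \<Rightarrow> 'd site" where
  "quadrant_site i c = origin y i + axis j (side i * \<sigma> * (fst c + 1)) + axis k (side i * \<tau> * snd c)"

definition arrival_time :: "int \<times> int \<Rightarrow> nat" where
  "arrival_time c = nat (fst c + snd c + 1)"

lemma y_nonzero: "y \<noteq> 0"
  using sign_j(2) by auto

lemma abs_side [simp]: "\<bar>side i\<bar> = 1"
  by (cases i) auto

lemma quadrant_step_in_unit_steps: "quadrant_step i u \<in> unit_steps"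
proof -
  have "\<sigma> \<in> {1, -1}" "\<tau> \<in> {1, -1}" using sign_j(1) sign_k(1) by auto
  then have "side i * \<sigma> \<in> {1, -1}" "side i * \<tau> \<in> {1, -1}" by (cases i; auto)+
  then show ?thesis unfolding quadrant_step_def unit_steps_def by auto
qed

lemma quadrant_site_origin: "quadrant_site i (0, 0) = origin y i + quadrant_step i North"
  by (simp add: quadrant_site_def quadrant_step_def axis_def vec_eq_iff)

lemma quadrant_site_right_cell:
  assumes "snd e \<in> {North, West}"
  shows "quadrant_site i (right_cell e) = quadrant_site i (left_cell e) + quadrant_step i (snd e)"
proof -
  obtain a b u where "e = ((a, b), u)" by (metis surj_pair)
  then show ?thesis
    using assms by (auto simp: quadrant_site_def quadrant_step_def axis_def vec_eq_iff algebra_simps)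
qed

lemma arrival_time_right_cell:
  assumes "snd e \<in> {North, West}" "0 \<le> fst (left_cell e)" "0 \<le> snd (left_cell e)"
  shows "arrival_time (right_cell e) = Suc (arrival_time (left_cell e))"
    "0 \<le> fst (right_cell e)" "0 \<le> snd (right_cell e)"
proof -
  obtain a b u where "e = ((a, b), u)" by (metis surj_pair)
  then show "arrival_time (right_cell e) = Suc (arrival_time (left_cell e))"
    "0 \<le> fst (right_cell e)" "0 \<le> snd (right_cell e)"
    using assms by (auto simp: arrival_time_def)
qed

lemma inj_quadrant_site: "inj (quadrant_site i)"
proof (rule injI)
  fix c d assume eq: "quadrant_site i c = quadrant_site i d"
  have "quadrant_site i c $ j = quadrant_site i d $ j" "quadrant_site i c $ k = quadrant_site i d $ k"
    by (simp_all add: eq)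
  moreover have "side i * \<sigma> \<noteq> 0" "side i * \<tau> \<noteq> 0"
    using sign_j(1) sign_k(1) by (cases i; auto)+
  ultimately show "c = d"
    using axes by (auto simp: quadrant_site_def axis_def prod_eq_iff)
qed

lemma norm_add_quadrant_axes:
  assumes "0 \<le> side i * (\<sigma> * z $ j)" "0 \<le> side i * (\<tau> * z $ k)" "0 \<le> s" "0 \<le> t"
  shows "norm_l1 (z + axis j (side i * \<sigma> * s) + axis k (side i * \<tau> * t)) = norm_l1 z + s + t"
proof -
  have "norm_l1 (z + axis j (side i * \<sigma> * s) + axis k (side i * \<tau> * t))
      = norm_l1 (z + axis j (side i * \<sigma> * s)) + t"
    using assms axes sign_k(1)
    by (intro norm_l1_add_axis) (auto simp: abs_mult axis_def mult.assoc)
  also have "norm_l1 (z + axis j (side i * \<sigma> * s)) = norm_l1 z + s"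
    using assms sign_j(1) by (intro norm_l1_add_axis) (auto simp: abs_mult mult.assoc)
  finally show ?thesis .
qed

lemma norm_quadrant_site:
  assumes "0 \<le> fst c" "0 \<le> snd c"
  shows "norm_l1 (quadrant_site i c - origin y i) = int (arrival_time c)"
  using norm_add_quadrant_axes[of i 0 "fst c + 1" "snd c"] assms
  by (simp add: quadrant_site_def arrival_time_def add.assoc)

lemma norm_quadrant_site_other:
  assumes "0 \<le> fst c" "0 \<le> snd c" "i' \<noteq> i"
  shows "norm_l1 (quadrant_site i c - origin y i') > int (arrival_time c)"
proof -
  define z where "z = origin y i - origin y i'"
  have z: "z = - y \<and> i = Type1 \<or> z = y \<and> i = Type2"
    using assms(3) by (cases i; cases i') (auto simp: z_def)
  have "quadrant_site i c - origin y i' =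
      z + axis j (side i * \<sigma> * (fst c + 1)) + axis k (side i * \<tau> * snd c)"
    by (simp add: quadrant_site_def z_def)
  also have "norm_l1 \<dots> = norm_l1 z + (fst c + 1) + snd c"
    using z assms sign_j sign_k by (intro norm_add_quadrant_axes) auto
  also have "norm_l1 z = norm_l1 y" using z by auto
  finally show ?thesis
    using norm_l1_pos[OF y_nonzero] assms by (simp add: arrival_time_def)
qed

lemma quadrant_site_not_initial:
  assumes "0 \<le> fst c" "0 \<le> snd c"
  shows "quadrant_site i c \<notin> {0, y}"
proof -
  have "arrival_time c > 0" using assms by (simp add: arrival_time_def)
  then have "quadrant_site i c \<noteq> origin y i'" for i'
    using norm_quadrant_site[OF assms, of i] norm_quadrant_site_other[OF assms, of i' i]
    by (cases "i' = i") auto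
  from this[of Type1] this[of Type2] show ?thesis by simp
qed

definition edge_coords ::
  "nat \<Rightarrow> frog_type \<Rightarrow> (int \<times> int) \<times> direction \<Rightarrow> ('d particle \<times> nat \<times> frog_type) set" where
  "edge_coords m i e = (\<lambda>l. ((quadrant_site i (left_cell e), l), arrival_time (left_cell e), i)) ` block m (snd e)"

definition open_edge ::
  "nat \<Rightarrow> frog_type \<Rightarrow> ('d particle \<times> nat \<times> frog_type \<Rightarrow> 'd site) \<Rightarrow> (int \<times> int) \<times> direction \<Rightarrow> bool" where
  "open_edge m i \<xi> e \<longleftrightarrow> (\<exists>c\<in>edge_coords m i e. \<xi> c = quadrant_step i (snd e))"

inductive_set cluster ::
  "nat \<Rightarrow> frog_type \<Rightarrow> ('d particle \<times> nat \<times> frog_type \<Rightarrow> 'd site) \<Rightarrow> (int \<times> int) set"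
  for m i \<xi> where
  origin: "(0, 0) \<in> cluster m i \<xi>"
| edge: "left_cell e \<in> cluster m i \<xi> \<Longrightarrow> snd e \<in> {North, West} \<Longrightarrow> open_edge m i \<xi> e
    \<Longrightarrow> right_cell e \<in> cluster m i \<xi>"

lemma cluster_nonneg:
  assumes "c \<in> cluster m i \<xi>" shows "0 \<le> fst c" "0 \<le> snd c"
proof -
  have "0 \<le> fst c \<and> 0 \<le> snd c"
    using assms by induction (auto simp: arrival_time_right_cell)
  then show "0 \<le> fst c" "0 \<le> snd c" by auto
qed

lemma finite_cluster_contour:
  assumes "finite (cluster m i \<xi>)"
  obtains n w where "n > 0" "length w = 2 * n" "card (crossings w) = n"
    "\<And>e. e \<in> crossings w \<Longrightarrow> 0 \<le> fst (left_cell e) \<and> 0 \<le> snd (left_cell e) \<and> \<not> open_edge m i \<xi> e"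
proof -
  have "(0, -1) \<notin> cluster m i \<xi>" using cluster_nonneg(2) by fastforce
  then obtain n w where w: "n > 0" "length w = 2 * n" "card (crossings w) = n"
      "crossings w \<subseteq> boundary (cluster m i \<xi>)"
    using peierls_contour[OF assms cluster.origin] by metis
  have "0 \<le> fst (left_cell e) \<and> 0 \<le> snd (left_cell e) \<and> \<not> open_edge m i \<xi> e"
    if "e \<in> crossings w" for e
  proof -
    have "left_cell e \<in> cluster m i \<xi>" "right_cell e \<notin> cluster m i \<xi>"
      using that w(4) by (auto simp: boundary_def)
    moreover have "snd e \<in> {North, West}"
      using that by (auto simp: crossings_def walk_edge_def)
    ultimately show ?thesis
      using cluster_nonneg[of "left_cell e" m i \<xi>] cluster.edge[of e m i \<xi>] by auto
  qed
  with w that show ?thesis by blast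
qed

context
  fixes \<eta> :: "'d site \<Rightarrow> nat" and tb :: "'d tie_rule" and \<omega> :: "'d sample" and m :: nat
  assumes unit_speed: "\<And>a n i. norm_l1 (fst \<omega> (a, n, i)) \<le> 1"
    and many: "\<And>x. x \<notin> {0, y} \<Longrightarrow> 2 * m \<le> \<eta> x"
    and first_step: "\<And>i. fst \<omega> ((origin y i, 0), 0, i) = quadrant_step i North"
begin

lemma cluster_activated:
  assumes "c \<in> cluster m i (fst \<omega>)" "l < \<eta> (quadrant_site i c)"
  shows "state_at y \<eta> tb \<omega> (arrival_time c) (quadrant_site i c, l) = Some (quadrant_site i c, i)"
  using assms
proof (induction arbitrary: l)
  case origin
  have "state_at y \<eta> tb \<omega> 0 (origin y i, 0) = Some (origin y i, i)"
    using y_nonzero by (cases i) (auto simp: initial_state_def)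
  moreover have "arrival_time (0, 0) = Suc 0" by (simp add: arrival_time_def)
  ultimately show ?case
    using activation_at_geodesic_time[OF unit_speed, of y \<eta> tb 0 "(origin y i, 0)" "origin y i" i
        "quadrant_site i (0, 0)" l] origin
      norm_quadrant_site[of "(0, 0)" i] norm_quadrant_site_other[of "(0, 0)" _ i]
    by (simp add: quadrant_site_origin first_step)
next
  case (edge e)
  note nonneg = cluster_nonneg[OF edge.hyps(1)]
  note right = arrival_time_right_cell[OF edge.hyps(2) nonneg]
  obtain l' where l': "l' \<in> block m (snd e)"
      "fst \<omega> ((quadrant_site i (left_cell e), l'), arrival_time (left_cell e), i) = quadrant_step i (snd e)"
    using edge.hyps(3) unfolding open_edge_def edge_coords_def by auto
  have "l' < 2 * m" using l'(1) by (auto simp: block_def split: if_splits)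
  also have "\<dots> \<le> \<eta> (quadrant_site i (left_cell e))"
    using nonneg by (intro many quadrant_site_not_initial)
  finally have "state_at y \<eta> tb \<omega> (arrival_time (left_cell e)) (quadrant_site i (left_cell e), l')
      = Some (quadrant_site i (left_cell e), i)"
    by (rule edge.IH)
  then show ?case
    unfolding right(1)
  proof (rule activation_at_geodesic_time[OF unit_speed])
    show "quadrant_site i (left_cell e) +
      fst \<omega> ((quadrant_site i (left_cell e), l'), arrival_time (left_cell e), i) = quadrant_site i (right_cell e)"
      using l'(2) quadrant_site_right_cell[OF edge.hyps(2)] by simp
    show "norm_l1 (quadrant_site i (right_cell e) - origin y i) = int (Suc (arrival_time (left_cell e)))"
      using norm_quadrant_site[OF right(2,3)] by (simp only: right(1))
    show "int (Suc (arrival_time (left_cell e))) < norm_l1 (quadrant_site i (right_cell e) - origin y i')"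
      if "i' \<noteq> i" for i'
      using norm_quadrant_site_other[OF right(2,3) that] by (simp only: right(1))
  qed (rule edge.prems)
qed

lemma infinite_cluster_survival:
  assumes "infinite (cluster m i (fst \<omega>))" "m > 0"
  shows "filterlim (\<lambda>n. card (active_set y \<eta> tb i \<omega> n)) at_top sequentially"
  unfolding filterlim_at_top
proof
  fix N
  obtain T where T: "T \<subseteq> cluster m i (fst \<omega>)" "finite T" "card T = N"
    using infinite_arbitrarily_large[OF assms(1)] by blast
  let ?f = "\<lambda>c. (quadrant_site i c, 0 :: nat)"
  show "eventually (\<lambda>n. N \<le> card (active_set y \<eta> tb i \<omega> n)) sequentially"
  proof (rule eventually_sequentiallyI)
    fix n assume n: "Max (arrival_time ` T) \<le> n"
    have "?f c \<in> active_set y \<eta> tb i \<omega> n" if "c \<in> T" for c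
    proof -
      have "c \<in> cluster m i (fst \<omega>)" using that T by auto
      moreover have "0 < \<eta> (quadrant_site i c)"
        using many[OF quadrant_site_not_initial[OF cluster_nonneg[OF calculation]], of i] \<open>m > 0\<close> by simp
      ultimately have "state_at y \<eta> tb \<omega> (arrival_time c) (?f c) = Some (quadrant_site i c, i)"
        by (rule cluster_activated)
      moreover have "arrival_time c \<le> n"
        using n that T(2) by (meson Max_ge finite_imageI imageI order_trans)
      ultimately show ?thesis
        unfolding active_set_def using state_at_persistent by blast
    qed
    then have "?f ` T \<subseteq> active_set y \<eta> tb i \<omega> n" by blast
    moreover have "finite (active_set y \<eta> tb i \<omega> n)"
      by (rule finite_subset[OF _ finite_dom_state_at[of y \<eta> tb \<omega> n]]) (auto simp: active_set_def)
    ultimately have "card (?f ` T) \<le> card (active_set y \<eta> tb i \<omega> n)"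
      by (rule card_mono[rotated])
    moreover have "inj_on ?f T"
      using inj_quadrant_site by (auto simp: inj_on_def inj_def)
    ultimately show "N \<le> card (active_set y \<eta> tb i \<omega> n)"
      using T(3) by (simp add: card_image)
  qed
qed

end

end

section \<open>Percolation in the quadrants\<close>

lemma finite_unit_steps: "finite (unit_steps :: 'd::finite site set)"
proof -
  have "(unit_steps :: 'd site set) = (\<lambda>(j, s). axis j s) ` (UNIV \<times> {1, -1})"
    by (auto simp: unit_steps_def)
  then have "unit_steps \<subseteq> (\<lambda>(j :: 'd, s :: int). axis j s) ` (UNIV \<times> {1, -1})" by (rule equalityD1)
  then show ?thesis by (rule finite_subset) simp
qed

lemma unit_steps_nonempty: "unit_steps \<noteq> {}"
  by (auto simp: unit_steps_def)

lemma norm_l1_unit_steps: "x \<in> unit_steps \<Longrightarrow> norm_l1 x = 1"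
  by (auto simp: unit_steps_def norm_l1_def axis_def if_distrib cong: if_cong)

lemma set_step_pmf: "set_pmf (step_pmf p) \<subseteq> insert 0 (unit_steps :: 'd::finite site set)"
  by (auto simp: step_pmf_def set_pmf_of_set[OF unit_steps_nonempty finite_unit_steps] split: if_splits)

lemma pmf_step_pmf_unit_step:
  assumes "p \<in> {0..1}" "x \<in> (unit_steps :: 'd::finite site set)"
  shows "pmf (step_pmf p) x = p / card (unit_steps :: 'd site set)"
proof -
  have "x \<noteq> 0" using norm_l1_unit_steps[OF assms(2)] by auto
  then show ?thesis
    using assms
    by (simp add: step_pmf_def pmf_bind pmf_of_set[OF unit_steps_nonempty finite_unit_steps]
        indicator_def)
qed

definition laziness :: "real \<Rightarrow> real \<Rightarrow> frog_type \<Rightarrow> real" where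
  "laziness p1 p2 i = (case i of Type1 \<Rightarrow> p1 | Type2 \<Rightarrow> p2)"

definition step_measure ::
  "real \<Rightarrow> real \<Rightarrow> ('d::finite particle \<times> nat \<times> frog_type \<Rightarrow> 'd site) measure" where
  "step_measure p1 p2 = PiM UNIV (\<lambda>c. measure_pmf (step_pmf (laziness p1 p2 (snd (snd c)))))"

lemma frog_measure_eq: "frog_measure p1 p2 R = step_measure p1 p2 \<Otimes>\<^sub>M R"
  unfolding frog_measure_def step_measure_def laziness_def by (simp add: case_prod_beta')

lemma space_step_measure [simp]: "space (step_measure p1 p2) = UNIV"
  by (simp add: step_measure_def space_PiM)

lemma prob_space_step_measure: "prob_space (step_measure p1 p2)"
  unfolding step_measure_def by (intro prob_space_PiM measure_pmf.prob_space_axioms)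

lemma cylinder_step_measure:
  assumes "finite J"
  shows "{\<xi>. \<forall>c\<in>J. \<xi> c \<in> X c} \<in> sets (step_measure p1 p2)" (is ?A)
    "measure (step_measure p1 p2) {\<xi>. \<forall>c\<in>J. \<xi> c \<in> X c} =
      (\<Prod>c\<in>J. measure_pmf.prob (step_pmf (laziness p1 p2 (snd (snd c)))) (X c))" (is ?B)
proof -
  let ?M = "\<lambda>c. measure_pmf (step_pmf (laziness p1 p2 (snd (snd c))))"
  interpret product_prob_space ?M UNIV ..
  have eq: "{\<xi>. \<forall>c\<in>J. \<xi> c \<in> X c} = prod_emb UNIV ?M J (Pi\<^sub>E J X)"
    by (auto simp: prod_emb_def Pi_iff)
  show ?A
    unfolding eq step_measure_def by (intro sets_PiM_I assms) auto
  show ?B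
    unfolding eq step_measure_def by (rule measure_PiM_emb) (use assms in auto)
qed

lemma AE_unit_speed: "AE \<xi> in (step_measure p1 p2 :: ('d::finite particle \<times> nat \<times> frog_type \<Rightarrow> 'd site) measure).
    \<forall>c. norm_l1 (\<xi> c) \<le> 1"
  unfolding AE_all_countable step_measure_def
proof
  fix c :: "'d particle \<times> nat \<times> frog_type"
  have "AE x in measure_pmf (step_pmf (laziness p1 p2 (snd (snd c)))). norm_l1 (x :: 'd site) \<le> 1"
    using set_step_pmf norm_l1_unit_steps by (fastforce simp: AE_measure_pmf_iff)
  then show "AE \<xi> in PiM UNIV (\<lambda>c. measure_pmf (step_pmf (laziness p1 p2 (snd (snd c))))).
      norm_l1 (\<xi> c :: 'd site) \<le> 1"
    by (intro AE_PiM_component[where P = "\<lambda>x. norm_l1 x \<le> 1"])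
      (auto intro: measure_pmf.prob_space_axioms)
qed

definition closed_walks :: "nat \<Rightarrow> direction list set" where
  "closed_walks n = {w. length w = 2 * n \<and> card (crossings w) = n \<and>
     (\<forall>e\<in>crossings w. 0 \<le> fst (left_cell e) \<and> 0 \<le> snd (left_cell e))}"

lemma closed_walks_subset:
  "closed_walks n \<subseteq> {w. set w \<subseteq> {East, North, West, South} \<and> length w = 2 * n}"
proof -
  have "u \<in> {East, North, West, South}" for u by (cases u) auto
  then show ?thesis unfolding closed_walks_def by blast
qed

lemma finite_closed_walks: "finite (closed_walks n)"
  by (rule finite_subset[OF closed_walks_subset finite_lists_length_eq]) simp

lemma card_closed_walks: "card (closed_walks n) \<le> 16 ^ n"
proof -
  have "card (closed_walks n) \<le> card {w. set w \<subseteq> {East, North, West, South} \<and> length w = 2 * n}"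
    by (intro card_mono closed_walks_subset finite_lists_length_eq) simp
  also have "\<dots> = 4 ^ (2 * n)"
  proof -
    have four: "card {East, North, West, South} = 4" by simp
    show ?thesis by (subst card_lists_length_eq) (simp, simp only: four)
  qed
  also have "\<dots> = 16 ^ n"
    by (simp add: power_mult)
  finally show ?thesis .
qed

lemma finite_crossings: "finite (crossings w)"
  by (simp add: crossings_def)

context opposite_quadrants
begin

definition initial_coords :: "('d particle \<times> nat \<times> frog_type) set" where
  "initial_coords = {((origin y i, 0), 0, i) | i. True}"

definition departure_event :: "('d particle \<times> nat \<times> frog_type \<Rightarrow> 'd site) set" where
  "departure_event = {\<xi>. \<forall>c\<in>initial_coords. \<xi> c \<in> {quadrant_step (snd (snd c)) North}}"

definition blocked_event ::
  "nat \<Rightarrow> frog_type \<Rightarrow> direction list \<Rightarrow> ('d particle \<times> nat \<times> frog_type \<Rightarrow> 'd site) set" where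
  "blocked_event m i w = {\<xi>. \<forall>e\<in>crossings w. \<not> open_edge m i \<xi> e}"

lemma finite_edge_coords: "finite (edge_coords m i e)"
  by (simp add: edge_coords_def block_def)

lemma card_edge_coords: "card (edge_coords m i e) = m"
  unfolding edge_coords_def
  by (subst card_image) (auto simp: inj_on_def block_def)

lemma edge_coords_disjoint:
  assumes "e \<in> crossings w" "f \<in> crossings w" "e \<noteq> f"
  shows "edge_coords m i e \<inter> edge_coords m i f = {}"
proof -
  obtain a b u where e: "e = ((a, b), u)" by (metis surj_pair)
  obtain a' b' u' where f: "f = ((a', b'), u')" by (metis surj_pair)
  have u: "u \<in> {North, West}" "u' \<in> {North, West}"
    using assms(1,2) by (auto simp: e f crossings_def walk_edge_def)
  show ?thesis
  proof (cases "u = u'")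
    case True
    with u assms(3) have "left_cell e \<noteq> left_cell f" by (auto simp: e f)
    then have "quadrant_site i (left_cell e) \<noteq> quadrant_site i (left_cell f)"
      using inj_quadrant_site by (meson injD)
    then show ?thesis by (auto simp: edge_coords_def)
  next
    case False
    with u have "block m u \<inter> block m u' = {}" by (auto simp: block_def)
    then show ?thesis by (auto simp: edge_coords_def e f)
  qed
qed

lemma finite_initial_coords: "finite initial_coords"
proof -
  have "initial_coords \<subseteq> {((origin y Type1, 0), 0, Type1), ((origin y Type2, 0), 0, Type2)}"
  proof
    fix c assume "c \<in> initial_coords"
    then obtain i where "c = ((origin y i, 0), 0, i)" by (auto simp: initial_coords_def)
    then show "c \<in> {((origin y Type1, 0), 0, Type1), ((origin y Type2, 0), 0, Type2)}"
      by (cases i) auto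
  qed
  then show ?thesis by (rule finite_subset) simp
qed

lemma departure_event_sets: "departure_event \<in> sets (step_measure p1 p2)"
  unfolding departure_event_def by (intro cylinder_step_measure finite_initial_coords)

lemma departure_event_pos:
  assumes "p1 \<in> {0<..1}" "p2 \<in> {0<..1}"
  shows "measure (step_measure p1 p2) departure_event > 0"
proof -
  have "laziness p1 p2 i \<in> {0<..1}" for i using assms by (cases i) (auto simp: laziness_def)
  moreover have "card (unit_steps :: 'd site set) > 0"
    using unit_steps_nonempty finite_unit_steps by (simp add: card_gt_0_iff)
  ultimately have "pmf (step_pmf (laziness p1 p2 i)) (quadrant_step i u) > 0" for i u
    using pmf_step_pmf_unit_step[OF _ quadrant_step_in_unit_steps, of "laziness p1 p2 i" i u]
    by (auto simp: less_imp_le)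
  then show ?thesis
    unfolding departure_event_def
    by (subst cylinder_step_measure[OF finite_initial_coords]) (auto intro!: prod_pos simp: measure_pmf_single)
qed

lemma departure_blocked_event:
  assumes p: "p1 \<in> {0<..1}" "p2 \<in> {0<..1}" and w: "w \<in> closed_walks n"
  shows "departure_event \<inter> blocked_event m i w \<in> sets (step_measure p1 p2)"
    and "measure (step_measure p1 p2) (departure_event \<inter> blocked_event m i w)
      \<le> measure (step_measure p1 p2) departure_event
          * (1 - min p1 p2 / card (unit_steps :: 'd site set)) ^ (m * n)"
proof -
  define J where "J = (\<Union>e\<in>crossings w. edge_coords m i e)"
  define X where "X c = (if c \<in> initial_coords then {quadrant_step (snd (snd c)) North}
     else - {quadrant_step i (if snd (fst c) < m then North else West)})" for c :: "'d particle \<times> nat \<times> frog_type"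
  let ?pr = "\<lambda>c. measure_pmf.prob (step_pmf (laziness p1 p2 (snd (snd c)))) (X c)"
  let ?N = "card (unit_steps :: 'd site set)"
  have disj: "initial_coords \<inter> J = {}"
  proof -
    have "c \<notin> initial_coords" if "e \<in> crossings w" "c \<in> edge_coords m i e" for c e
    proof -
      have "arrival_time (left_cell e) > 0"
        using w that(1) by (auto simp: closed_walks_def arrival_time_def)
      with that(2) show ?thesis by (auto simp: edge_coords_def initial_coords_def)
    qed
    then show ?thesis by (auto simp: J_def)
  qed
  have finJ: "finite J" "finite (initial_coords \<union> J)"
    by (auto simp: J_def finite_crossings finite_edge_coords finite_initial_coords)
  have cardJ: "card J = m * n"
    unfolding J_def using w
    by (subst card_UN_disjoint)
      (auto simp: finite_crossings finite_edge_coords card_edge_coords closed_walks_def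
        dest: edge_coords_disjoint)
  have blocked: "blocked_event m i w = {\<xi>. \<forall>c\<in>J. \<xi> c \<in> X c}"
  proof -
    have "\<xi> c \<noteq> quadrant_step i (snd e) \<longleftrightarrow> \<xi> c \<in> X c"
      if "e \<in> crossings w" "c \<in> edge_coords m i e" for e c \<xi>
    proof -
      have "c \<notin> initial_coords" using that disj by (auto simp: J_def)
      moreover have "snd e \<in> {North, West}"
        using that(1) by (auto simp: crossings_def walk_edge_def)
      then have "snd e = (if snd (fst c) < m then North else West)"
        using that(2) by (auto simp: edge_coords_def block_def)
      ultimately show ?thesis by (simp add: X_def)
    qed
    then show ?thesis
      unfolding blocked_event_def open_edge_def J_def by blast
  qed
  have both: "departure_event \<inter> blocked_event m i w = {\<xi>. \<forall>c\<in>initial_coords \<union> J. \<xi> c \<in> X c}"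
    unfolding blocked departure_event_def by (auto simp: X_def)
  show "departure_event \<inter> blocked_event m i w \<in> sets (step_measure p1 p2)"
    unfolding both by (rule cylinder_step_measure[OF finJ(2)])
  have "measure (step_measure p1 p2) (departure_event \<inter> blocked_event m i w)
      = (\<Prod>c\<in>initial_coords \<union> J. ?pr c)"
    unfolding both by (rule cylinder_step_measure[OF finJ(2)])
  also have "\<dots> = (\<Prod>c\<in>initial_coords. ?pr c) * (\<Prod>c\<in>J. ?pr c)"
    by (intro prod.union_disjoint finite_initial_coords finJ disj)
  also have "(\<Prod>c\<in>initial_coords. ?pr c) = measure (step_measure p1 p2) departure_event"
    unfolding departure_event_def cylinder_step_measure(2)[OF finite_initial_coords]
    by (intro prod.cong) (auto simp: X_def)
  also have "(\<Prod>c\<in>J. ?pr c) \<le> (\<Prod>c\<in>J. 1 - min p1 p2 / ?N)"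
  proof (intro prod_mono conjI measure_nonneg)
    fix c assume "c \<in> J"
    let ?q = "laziness p1 p2 (snd (snd c))"
    have q: "?q \<in> {0..1}" "min p1 p2 \<le> ?q"
      using p by (cases "snd (snd c)"; auto simp: laziness_def)+
    have "c \<notin> initial_coords" using \<open>c \<in> J\<close> disj by auto
    then obtain u where "X c = - {quadrant_step i u}" by (auto simp: X_def)
    then have "?pr c = 1 - pmf (step_pmf ?q) (quadrant_step i u)"
      using measure_pmf.prob_compl[of "{quadrant_step i u}" "step_pmf ?q"]
      by (simp add: Compl_eq_Diff_UNIV measure_pmf_single)
    also have "pmf (step_pmf ?q) (quadrant_step i u) = ?q / ?N"
      by (rule pmf_step_pmf_unit_step[OF q(1) quadrant_step_in_unit_steps])
    also have "1 - ?q / ?N \<le> 1 - min p1 p2 / ?N"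
      using q(2) by (simp add: divide_right_mono)
    finally show "?pr c \<le> 1 - min p1 p2 / ?N" .
  qed
  also have "\<dots> = (1 - min p1 p2 / ?N) ^ (m * n)"
    by (simp add: cardJ)
  finally show "measure (step_measure p1 p2) (departure_event \<inter> blocked_event m i w)
      \<le> measure (step_measure p1 p2) departure_event * (1 - min p1 p2 / ?N) ^ (m * n)"
    by (simp add: mult_left_mono)
qed

lemma percolation_pos:
  assumes p: "p1 \<in> {0<..1}" "p2 \<in> {0<..1}"
    and m: "(1 - min p1 p2 / card (unit_steps :: 'd site set)) ^ m \<le> 1 / 64"
  shows "\<exists>A \<in> sets (step_measure p1 p2). measure (step_measure p1 p2) A > 0 \<and>
    A \<subseteq> {\<xi> \<in> departure_event. \<forall>i. infinite (cluster m i \<xi>)}"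
proof -
  interpret prob_space "step_measure p1 p2" by (rule prob_space_step_measure)
  let ?r = "1 - min p1 p2 / card (unit_steps :: 'd site set)"
  let ?f = "prob departure_event"
  have r: "0 \<le> ?r"
  proof -
    have "card (unit_steps :: 'd site set) \<ge> 1"
      using unit_steps_nonempty finite_unit_steps by (simp add: Suc_le_eq card_gt_0_iff)
    then show ?thesis using p by (auto simp: min_def field_simps)
  qed
  define V where "V n = (\<Union>(i, w)\<in>{Type1, Type2} \<times> closed_walks (Suc n). departure_event \<inter> blocked_event m i w)" for n
  have V_sets: "V n \<in> events" for n
    unfolding V_def using departure_blocked_event(1)[OF p]
    by (intro sets.finite_UN finite_cartesian_product finite_closed_walks) auto
  have V_le: "prob (V n) \<le> (2 * ?f / 4) * (1 / 4) ^ n" for n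
  proof -
    have "prob (V n) \<le> (\<Sum>(i, w)\<in>{Type1, Type2} \<times> closed_walks (Suc n). prob (departure_event \<inter> blocked_event m i w))"
      unfolding V_def case_prod_beta using departure_blocked_event(1)[OF p]
      by (intro finite_measure_subadditive_finite finite_cartesian_product finite_closed_walks) auto
    also have "\<dots> \<le> (\<Sum>(i, w)\<in>{Type1, Type2} \<times> closed_walks (Suc n). ?f * (1 / 64) ^ Suc n)"
    proof (intro sum_mono, clarsimp simp del: power_Suc)
      fix i w assume "w \<in> closed_walks (Suc n)"
      then have "prob (departure_event \<inter> blocked_event m i w) \<le> ?f * (?r ^ m) ^ Suc n"
        using departure_blocked_event(2)[OF p, of w "Suc n" m i] by (simp only: power_mult)
      also have "\<dots> \<le> ?f * (1 / 64) ^ Suc n"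
        using m r by (intro mult_left_mono power_mono) auto
      finally show "prob (departure_event \<inter> blocked_event m i w) \<le> ?f * (1 / 64) ^ Suc n" .
    qed
    also have "\<dots> = 2 * real (card (closed_walks (Suc n))) * (?f * (1 / 64) ^ Suc n)"
      by (simp add: card_cartesian_product)
    also have "\<dots> \<le> 2 * 16 ^ Suc n * (?f * (1 / 64) ^ Suc n)"
    proof (intro mult_right_mono mult_left_mono)
      show "real (card (closed_walks (Suc n))) \<le> 16 ^ Suc n"
        using of_nat_mono[OF card_closed_walks[of "Suc n"], where 'a = real]
        by (simp only: of_nat_power of_nat_numeral)
    qed simp_all
    also have "\<dots> = 2 * ?f * (16 * (1 / 64)) ^ Suc n"
      by (simp only: power_mult_distrib mult_ac)
    also have "\<dots> = (2 * ?f / 4) * (1 / 4) ^ n"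
      by simp
    finally show ?thesis .
  qed
  have geometric: "(\<lambda>n. (2 * ?f / 4) * (1 / 4 :: real) ^ n) sums ((2 * ?f / 4) * (1 / (1 - 1 / 4)))"
    by (intro sums_mult geometric_sums) simp
  have summable: "summable (\<lambda>n. prob (V n))"
    by (rule summable_comparison_test'[OF sums_summable[OF geometric]]) (use V_le in simp)
  have "prob (\<Union>n. V n) \<le> (\<Sum>n. prob (V n))"
    using V_sets by (intro finite_measure_subadditive_countably summable) auto
  also have "\<dots> \<le> (2 * ?f / 4) * (1 / (1 - 1 / 4))"
    using suminf_le[OF V_le summable sums_summable[OF geometric]] sums_unique[OF geometric] by simp
  also have "\<dots> < ?f"
    using departure_event_pos[OF p] by simp
  finally have less: "prob (\<Union>n. V n) < ?f" .
  have U: "(\<Union>n. V n) \<in> events" using V_sets by auto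
  have sub: "(\<Union>n. V n) \<subseteq> departure_event" by (auto simp: V_def)
  have "prob (departure_event - (\<Union>n. V n)) = ?f - prob (\<Union>n. V n)"
    by (rule finite_measure_Diff[OF departure_event_sets U sub])
  with less have "prob (departure_event - (\<Union>n. V n)) > 0" by simp
  moreover have "infinite (cluster m i \<xi>)" if \<xi>: "\<xi> \<in> departure_event" "\<xi> \<notin> (\<Union>n. V n)" for \<xi> i
  proof
    assume "finite (cluster m i \<xi>)"
    then obtain n w where w: "n > 0" "length w = 2 * n" "card (crossings w) = n"
        "\<And>e. e \<in> crossings w \<Longrightarrow> 0 \<le> fst (left_cell e) \<and> 0 \<le> snd (left_cell e) \<and> \<not> open_edge m i \<xi> e"
      by (rule finite_cluster_contour) blast
    obtain n' where n': "n = Suc n'" using w(1) by (cases n) auto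
    have "w \<in> closed_walks (Suc n')" "\<xi> \<in> blocked_event m i w"
      using w(2-4) by (simp_all add: closed_walks_def blocked_event_def n')
    moreover have "i \<in> {Type1, Type2}" by (cases i) auto
    ultimately have "\<xi> \<in> V n'" unfolding V_def using \<xi>(1) by blast
    with \<xi>(2) show False by blast
  qed
  ultimately show ?thesis
    using departure_event_sets U by (intro bexI[of _ "departure_event - (\<Union>n. V n)"]) auto
qed

lemma coexistence_pos:
  fixes \<eta> :: "'d site \<Rightarrow> nat" and tb :: "'d tie_rule"
  assumes p: "p1 \<in> {0<..1}" "p2 \<in> {0<..1}"
    and m: "m > 0" "(1 - min p1 p2 / card (unit_steps :: 'd site set)) ^ m \<le> 1 / 64"
    and many: "\<And>x. x \<notin> {0, y} \<Longrightarrow> 2 * m \<le> \<eta> x"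
    and tb: "tie_breaking R tb"
  shows "measure (frog_measure p1 p2 R) (G_event p1 p2 R y \<eta> tb Type1 \<inter> G_event p1 p2 R y \<eta> tb Type2) > 0"
proof -
  interpret S: prob_space "step_measure p1 p2 :: ('d particle \<times> nat \<times> frog_type \<Rightarrow> 'd site) measure"
    by (rule prob_space_step_measure)
  interpret R: prob_space R using tb by (simp add: tie_breaking_def)
  interpret SR: pair_prob_space "step_measure p1 p2 :: ('d particle \<times> nat \<times> frog_type \<Rightarrow> 'd site) measure" R ..
  let ?G = "G_event p1 p2 R y \<eta> tb Type1 \<inter> G_event p1 p2 R y \<eta> tb Type2"
  obtain A where A: "A \<in> S.events" "S.prob A > 0"
      "A \<subseteq> {\<xi> \<in> departure_event. \<forall>i. infinite (cluster m i \<xi>)}"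
    using percolation_pos[OF p m(2)] by blast
  obtain N where N: "N \<subseteq> {\<xi>. \<forall>c. norm_l1 (\<xi> c) \<le> 1}" "N \<in> S.events" "S.prob N = 1"
    using S.AE_E_prob[OF AE_unit_speed] by auto
  have AN: "S.prob (A \<inter> N) = S.prob A"
    using S.AE_prob_1[OF N(3)] A(1) N(2) by (intro S.finite_measure_eq_AE) auto
  have "(A \<inter> N) \<times> space R \<subseteq> ?G"
  proof
    fix \<omega> assume \<omega>: "\<omega> \<in> (A \<inter> N) \<times> space R"
    then have fst: "fst \<omega> \<in> A" "fst \<omega> \<in> N" by auto
    have "fst \<omega> ((origin y i, 0), 0, i) = quadrant_step i North" for i
      using fst(1) A(3) by (force simp: departure_event_def initial_coords_def)
    moreover have "norm_l1 (fst \<omega> (a, n, i)) \<le> 1" for a n i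
      using fst(2) N(1) by blast
    moreover have "infinite (cluster m i (fst \<omega>))" for i
      using fst(1) A(3) by blast
    ultimately have "filterlim (\<lambda>n. card (active_set y \<eta> tb i \<omega> n)) at_top sequentially" for i
      using infinite_cluster_survival[of \<omega> m \<eta> i tb] many m(1) by blast
    moreover have "\<omega> \<in> space (frog_measure p1 p2 R)"
      using \<omega> by (auto simp: frog_measure_eq space_pair_measure)
    ultimately show "\<omega> \<in> ?G" by (simp add: G_event_def)
  qed
  moreover have "?G \<in> sets (frog_measure p1 p2 R)"
    using tb by (intro sets.Int measurable_G_event)
  ultimately have "measure (frog_measure p1 p2 R) ((A \<inter> N) \<times> space R) \<le> measure (frog_measure p1 p2 R) ?G"
    unfolding frog_measure_eq by (rule SR.finite_measure_mono)
  moreover have "measure (frog_measure p1 p2 R) ((A \<inter> N) \<times> space R) = S.prob (A \<inter> N) * R.prob (space R)"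
    unfolding frog_measure_eq using A(1) N(2)
    by (simp add: measure_def R.emeasure_pair_measure_Times enn2real_mult)
  ultimately show ?thesis
    using A(2) AN by (simp add: R.prob_space)
qed

end

theorem theorem3p1:
  assumes "CARD('d::finite) \<ge> 2"
  shows "\<exists>M :: real \<Rightarrow> nat. \<forall>p1 p2. p1 \<in> {0<..1} \<longrightarrow> p2 \<in> {0<..1} \<longrightarrow>
    (\<forall>(y :: int ^ 'd) \<eta> R tb.
       y \<noteq> 0 \<longrightarrow>
       (\<forall>x. x \<notin> {0, y} \<longrightarrow> \<eta> x \<ge> M (min p1 p2)) \<longrightarrow>
       tie_breaking R tb \<longrightarrow>
       measure (frog_measure p1 p2 R)
         (G_event p1 p2 R y \<eta> tb Type1 \<inter> G_event p1 p2 R y \<eta> tb Type2) > 0)"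
proof -
  let ?N = "card (unit_steps :: 'd site set)"
  have N: "?N \<ge> 1"
    using unit_steps_nonempty finite_unit_steps by (simp add: Suc_le_eq card_gt_0_iff)
  have "\<exists>m. m > 0 \<and> (1 - p / ?N) ^ m \<le> 1 / 64" if "p \<in> {0<..1}" for p :: real
  proof -
    have "0 \<le> 1 - p / ?N" "1 - p / ?N < 1" using that N by (auto simp: field_simps)
    then obtain m where m: "(1 - p / ?N) ^ m < 1 / 64"
      using real_arch_pow_inv[of "1 / 64" "1 - p / ?N"] by auto
    then have "m > 0" by (cases m) auto
    with m show ?thesis by (auto intro: less_imp_le)
  qed
  then obtain m where m: "\<And>p. p \<in> {0<..1} \<Longrightarrow> m p > 0 \<and> (1 - p / ?N) ^ m p \<le> 1 / 64"
    by metis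
  show ?thesis
  proof (intro exI[of _ "\<lambda>p. 2 * m p"] allI impI)
    fix p1 p2 :: real and y :: "int ^ 'd" and \<eta> R tb
    assume p: "p1 \<in> {0<..1}" "p2 \<in> {0<..1}" and y: "y \<noteq> 0"
      and many: "\<forall>x. x \<notin> {0, y} \<longrightarrow> 2 * m (min p1 p2) \<le> \<eta> x"
      and tb: "tie_breaking R (tb :: 'd tie_rule)"
    obtain j where j: "y $ j \<noteq> 0" using y by (auto simp: vec_eq_iff)
    obtain k where k: "j \<noteq> k"
    proof -
      have "\<not> UNIV \<subseteq> {j}"
        using card_mono[of "{j}" UNIV] assms by auto
      then obtain x where "x \<noteq> j" by blast
      then show ?thesis using that[of x] by auto
    qed
    interpret opposite_quadrants y j k "sgn (y $ j)" "if y $ k \<ge> 0 then 1 else - 1"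
      using j k by unfold_locales (auto simp: sgn_if)
    have "min p1 p2 \<in> {0<..1}" using p by auto
    with m[of "min p1 p2"] many show "measure (frog_measure p1 p2 R)
        (G_event p1 p2 R y \<eta> tb Type1 \<inter> G_event p1 p2 R y \<eta> tb Type2) > 0"
      by (intro coexistence_pos[OF p _ _ _ tb, of "m (min p1 p2)"]) auto
  qed
qed

end
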